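(* Let $n\ge2$, $k>0$, and let $\lambda_1,\dots,\lambda_n>0$ be pairwise distinct. Let $Z\sim MHW(k,\lambda_1,\dots,\lambda_n)$, let $Y_i\sim\mathrm{Weibull}(k,\lambda_i)$ for $i=1,\dots,n$, and put $PW_i=\prod_{j=1,\,j\neq i}^n\left(1-\left(\frac{\lambda_j}{\lambda_i}\right)^k\right)$. Then $$F_Z(t)=\sum_{i=1}^n\frac{1}{PW_i}F_{Y_i}(t),\qquad R_Z(t)=\sum_{i=1}^n\frac{1}{PW_i}R_{Y_i}(t),\qquad h_Z(t)=\frac{\sum_{i=1}^n\frac{1}{PW_i}f_{Y_i}(t)}{\sum_{i=1}^n\frac{1}{PW_i}R_{Y_i}(t)},$$ $$\Phi_Z(t)=\sum_{i=1}^n\frac{1}{PW_i}\Phi_{Y_i}(t),\qquad E[Z^h]=\sum_{i=1}^n\frac{1}{PW_i}E[Y_i^h],$$ where the identities for $F_Z$ and $R_Z$ hold for all real $t$, the one for $h_Z$ for all $t$ with $R_Z(t)>0$, the one for $\Phi_Z$ for all $t$ at which all $\Phi_{Y_i}(t)$ are finite, and the last one for every positive integer $h$.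
   Context: $\mathrm{Weibull}(k,\lambda)$ with shape $k>0$ and scale $\lambda>0$ has density $\frac{k}{\lambda}\left(\frac{t}{\lambda}\right)^{k-1}e^{-(t/\lambda)^{k}}$ for $t>0$ (and $0$ otherwise). The Mixed Hypoexponential Weibull distribution $MHW(k,\lambda_1,\dots,\lambda_n)$ is the distribution with density $f_Z(t)=\sum_{i=1}^n\frac{1}{PW_i}f_{Y_i}(t)$. For a random variable $X$ with density $f_X$: $F_X$ is its cumulative distribution function, $R_X(t)=P(X>t)$ its reliability function, $h_X(t)=f_X(t)/R_X(t)$ its hazard rate function, and $\Phi_X(t)=E[e^{tX}]$ its moment generating function. *)

theory Defs
  imports "HOL-Probability.Probability"
begin

definition weibull_density :: "real \<Rightarrow> real \<Rightarrow> real \<Rightarrow> real" where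
  "weibull_density k l t =
     (if t > 0 then k / l * (t / l) powr (k - 1) * exp (- ((t / l) powr k)) else 0)"

definition PW :: "nat \<Rightarrow> real \<Rightarrow> (nat \<Rightarrow> real) \<Rightarrow> nat \<Rightarrow> real" where
  "PW n k l i = (\<Prod>j \<in> {1..n} - {i}. 1 - (l j / l i) powr k)"

text \<open>
  Some of the weights \<open>1 / PW n k l i\<close> are negative. A random variable with the mixed
  hypoexponential Weibull distribution is one satisfying
  \<open>distributed M lborel Z (\<lambda>t. ennreal (mhw_density n k l t))\<close>. The coercion \<open>ennreal\<close> sends negative
  reals to \<open>0\<close>, so this does not presuppose that \<open>mhw_density\<close> is nonnegative.
\<close>

definition mhw_density :: "nat \<Rightarrow> real \<Rightarrow> (nat \<Rightarrow> real) \<Rightarrow> real \<Rightarrow> real" where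
  "mhw_density n k l t = (\<Sum>i=1..n. 1 / PW n k l i * weibull_density k (l i) t)"

definition reliability :: "'a measure \<Rightarrow> ('a \<Rightarrow> real) \<Rightarrow> real \<Rightarrow> real" where
  "reliability M X t = \<P>(x in M. X x > t)"

text \<open>
  A density is determined only almost everywhere, so the hazard rate takes the chosen
  density \<open>f\<close> of \<open>X\<close> as a parameter.
\<close>

definition hazard_rate :: "'a measure \<Rightarrow> ('a \<Rightarrow> real) \<Rightarrow> (real \<Rightarrow> real) \<Rightarrow> real \<Rightarrow> real" where
  "hazard_rate M X f t = f t / reliability M X t"

text \<open>
  The Bochner integral is \<open>0\<close> on non-integrable functions, so finiteness of the moment
  generating function at \<open>t\<close> is expressed by \<open>integrable M (\<lambda>x. exp (t * X x))\<close>.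
\<close>

definition mgf :: "'a measure \<Rightarrow> ('a \<Rightarrow> real) \<Rightarrow> real \<Rightarrow> real" where
  "mgf M X t = (\<integral>x. exp (t * X x) \<partial>M)"

end

theory Submission
  imports Defs
begin

text \<open>
  With \<open>y\<^sub>i = l\<^sub>i powr (- k)\<close>, the weight \<open>1 / PW\<^sub>i\<close> is the value at \<open>0\<close> of the
  \<open>i\<close>-th Lagrange basis polynomial for the nodes \<open>y\<^sub>1, \<dots>, y\<^sub>n\<close>, so the weights sum to \<open>1\<close>.
  Hence the signed mixture has total integral \<open>1\<close>. Its positive part also has integral \<open>1\<close>, being
  the density of a random variable, so the mixture is nonnegative almost everywhere and is a genuine
  density. All identities are then linearity of the integral. For the moments, \<open>x ^ h\<close> is at most a
  constant times \<open>exp ((x / l) powr k / 2)\<close>, and the product of this bound with the Weibull density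
  has an explicit bounded primitive.
\<close>

section \<open>Lagrange interpolation and the sum of the weights\<close>

text \<open>The sum of the basis polynomials has degree below \<open>card I\<close> and takes the
  value 1 at all \<open>card I\<close> nodes, so it is the constant polynomial 1.\<close>

lemma lagrange_basis_sum_eq_1:
  fixes y :: "'i \<Rightarrow> 'a::field"
  assumes fin: "finite I" and ne: "I \<noteq> {}" and inj: "inj_on y I"
  shows "(\<Sum>i\<in>I. \<Prod>j\<in>I - {i}. (x - y j) / (y i - y j)) = 1"
proof -
  define L where "L i = (\<Prod>j\<in>I - {i}. smult (inverse (y i - y j)) [:- y j, 1:])" for i
  have poly_L: "poly (L i) z = (\<Prod>j\<in>I - {i}. (z - y j) / (y i - y j))" for i z
    unfolding L_def by (simp add: poly_prod divide_inverse mult.commute algebra_simps)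
  have deg: "degree (L i) \<le> card I - 1" if "i \<in> I" for i
  proof -
    have "degree (L i) \<le> (\<Sum>j\<in>I - {i}. degree (smult (inverse (y i - y j)) [:- y j, 1:]))"
      unfolding L_def by (rule degree_prod_sum_le[unfolded o_def]) (use fin in auto)
    also have "\<dots> \<le> (\<Sum>j\<in>I - {i}. 1)"
      by (rule sum_mono) (simp add: degree_smult_le)
    finally show ?thesis using fin that by simp
  qed
  have node: "poly (\<Sum>i\<in>I. L i) (y m) = 1" if m: "m \<in> I" for m
  proof -
    have "poly (L i) (y m) = (if i = m then 1 else 0)" if "i \<in> I" for i
    proof (cases "i = m")
      case True
      then show ?thesis
        unfolding poly_L using inj m by (auto intro!: prod.neutral simp: inj_on_eq_iff split: if_splits)
    next
      case False
      then show ?thesis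
        using fin m by (auto simp: poly_L intro!: prod_zero)
    qed
    then show ?thesis using fin m by (simp add: poly_sum)
  qed
  have "(\<Sum>i\<in>I. L i) = 1"
  proof (rule poly_eqI_degree[of "y ` I"])
    have pos: "card I > 0" using fin ne by auto
    have "degree (\<Sum>i\<in>I. L i) \<le> card I - 1"
      by (rule degree_sum_le[OF fin deg])
    then show "degree (\<Sum>i\<in>I. L i) < card (y ` I)"
      using pos inj by (simp add: card_image)
    show "degree (1 :: 'a poly) < card (y ` I)"
      using pos inj by (simp add: card_image)
  qed (use node in auto)
  then have "poly (\<Sum>i\<in>I. L i) x = 1" by simp
  then show ?thesis by (simp add: poly_sum poly_L)
qed

lemma sum_inverse_PW:
  assumes n: "n \<ge> 1" and k: "k > 0"
    and l: "\<And>i. i \<in> {1..n} \<Longrightarrow> l i > 0" and inj: "inj_on l {1..n}"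
  shows "(\<Sum>i=1..n. 1 / PW n k l i) = 1"
proof -
  define y where "y i = l i powr (- k)" for i
  have ypos: "y i > 0" if "i \<in> {1..n}" for i
    using l[OF that] by (simp add: y_def)
  have injy: "inj_on y {1..n}"
  proof (rule inj_onI)
    fix i j assume ij: "i \<in> {1..n}" "j \<in> {1..n}" "y i = y j"
    \<comment> \<open>The exponent \<open>- 1 / k\<close> undoes \<open>- k\<close> on positive
      reals.\<close>
    then have "(l i powr (- k)) powr (- 1 / k) = (l j powr (- k)) powr (- 1 / k)"
      by (simp add: y_def)
    then have "l i = l j" using k l[OF ij(1)] l[OF ij(2)] by (simp add: powr_powr)
    then show "i = j" using inj ij by (auto dest: inj_onD)
  qed
  have "1 / PW n k l i = (\<Prod>j\<in>{1..n} - {i}. (0 - y j) / (y i - y j))" if i: "i \<in> {1..n}" for i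
  proof -
    \<comment> \<open>Since \<open>(l j / l i) powr k = y i / y j\<close>, each factor is a Lagrange
      factor at \<open>0\<close>, after clearing \<open>y j\<close>.\<close>
    have "1 / (1 - (l j / l i) powr k) = (0 - y j) / (y i - y j)" if j: "j \<in> {1..n} - {i}" for j
    proof -
      have eq: "(l j / l i) powr k = y i / y j"
        using l[OF i] l[of j] j by (simp add: y_def powr_divide powr_minus field_simps)
      have "y j \<noteq> 0" "y i \<noteq> y j"
        using ypos[of j] j injy i by (auto dest: inj_onD)
      then show ?thesis unfolding eq by (simp add: divide_simps) (simp add: algebra_simps)
    qed
    then show ?thesis
      \<comment> \<open>The numerator 1 becomes a product of ones, so that the quotient is taken
        factor by factor.\<close>
      unfolding PW_def by (subst prod.neutral_const[symmetric], subst prod_dividef[symmetric])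
        (rule prod.cong, auto)
  qed
  then have "(\<Sum>i=1..n. 1 / PW n k l i)
      = (\<Sum>i=1..n. \<Prod>j\<in>{1..n} - {i}. (0 - y j) / (y i - y j))"
    by (intro sum.cong) auto
  also have "\<dots> = 1" using n injy by (intro lagrange_basis_sum_eq_1) auto
  finally show ?thesis .
qed

section \<open>Expectations under signed mixtures of densities\<close>

text \<open>As \<open>ennreal\<close> truncates at 0, \<open>max 0 f\<close> is also a density of
  \<open>X\<close> and has integral 1. Then \<open>max 0 f - f\<close> is nonnegative with integral
  0, so it vanishes almost everywhere.\<close>

lemma AE_nonneg_if_distributed:
  fixes f :: "'c \<Rightarrow> real"
  assumes M: "prob_space M" and D: "distributed M L X (\<lambda>x. ennreal (f x))"
    and f: "integrable L f" "(\<integral>x. f x \<partial>L) = 1"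
  shows "AE x in L. 0 \<le> f x"
proof -
  interpret prob_space M by fact
  have D': "distributed M L X (\<lambda>x. ennreal (max 0 (f x)))"
    using D by (simp add: ennreal_max_0')
  have int_max: "integrable L (\<lambda>x. max 0 (f x))" using f(1) by simp
  have "(\<integral>x. max 0 (f x) * 1 \<partial>L) = (\<integral>x. 1 \<partial>M)"
    by (rule distributed_integral[OF D']) auto
  then have "(\<integral>x. max 0 (f x) - f x \<partial>L) = 0"
    using f int_max by (simp add: prob_space)
  then have "AE x in L. max 0 (f x) - f x = 0"
    using f(1) int_max by (subst (asm) integral_nonneg_eq_0_iff_AE) auto
  then show ?thesis by eventually_elim (simp add: max_def split: if_splits)
qed

text \<open>One test function \<open>g\<close> covers indicators, exponentials and powers. Both
  sides become integrals over \<open>L\<close>, where the mixture is a finite linear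
  combination.\<close>

lemma signed_mixture_expectation:
  fixes w :: "'i \<Rightarrow> real" and f :: "'i \<Rightarrow> 'c \<Rightarrow> real" and g :: "'c \<Rightarrow> real"
  assumes M: "prob_space M" and w: "(\<Sum>i\<in>I. w i) = 1"
    and Z: "distributed M L Z (\<lambda>x. ennreal (\<Sum>i\<in>I. w i * f i x))"
    and N: "\<And>i. i \<in> I \<Longrightarrow> prob_space (N i)"
    and Y: "\<And>i. i \<in> I \<Longrightarrow> distributed (N i) L (Y i) (\<lambda>x. ennreal (f i x))"
    and f: "\<And>i x. i \<in> I \<Longrightarrow> 0 \<le> f i x"
    and g: "g \<in> borel_measurable L"
    and int: "\<And>i. i \<in> I \<Longrightarrow> integrable (N i) (\<lambda>x. g (Y i x))"
  shows "integrable M (\<lambda>x. g (Z x))"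
    and "(\<integral>x. g (Z x) \<partial>M) = (\<Sum>i\<in>I. w i * (\<integral>x. g (Y i x) \<partial>N i))"
proof -
  let ?f = "\<lambda>x. \<Sum>i\<in>I. w i * f i x"
  \<comment> \<open>Used with \<open>u\<close> constantly 1 for the total mass and with
    \<open>u = g\<close> for the expectation.\<close>
  have transfer: "integrable L (\<lambda>x. f i x * u x) \<longleftrightarrow> integrable (N i) (\<lambda>x. u (Y i x))"
      "(\<integral>x. f i x * u x \<partial>L) = (\<integral>x. u (Y i x) \<partial>N i)"
    if "i \<in> I" "u \<in> borel_measurable L" for i and u :: "'c \<Rightarrow> real"
    using distributed_integrable[OF Y] distributed_integral[OF Y] f that by auto
  have f1: "integrable L (f i)" "(\<integral>x. f i x \<partial>L) = 1" if i: "i \<in> I" for i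
  proof -
    interpret prob_space "N i" using N i .
    show "integrable L (f i)" "(\<integral>x. f i x \<partial>L) = 1"
      using transfer[OF i, of "\<lambda>_. 1"] by (simp_all add: prob_space)
  qed
  have int_f: "integrable L ?f" using f1 by auto
  have "AE x in L. 0 \<le> ?f x"
    by (rule AE_nonneg_if_distributed[OF M Z int_f]) (use f1 w in simp)
  then have ae: "AE x in L. max 0 (?f x) * g x = ?f x * g x"
    by eventually_elim simp
  \<comment> \<open>The transfer rules for densities ask for nonnegativity at every point, not just
    almost everywhere; the truncated mixture provides it.\<close>
  have Z': "distributed M L Z (\<lambda>x. ennreal (max 0 (?f x)))"
    using Z by (simp add: ennreal_max_0')
  have meas: "?f \<in> borel_measurable L" using int_f by auto
  have expand: "?f x * g x = (\<Sum>i\<in>I. w i * (f i x * g x))" for x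
    by (simp add: sum_distrib_right mult.assoc)
  have int_fg: "integrable L (\<lambda>x. f i x * g x)" if "i \<in> I" for i
    using transfer(1)[OF that g] int[OF that] by simp
  have "integrable L (\<lambda>x. max 0 (?f x) * g x) \<longleftrightarrow> integrable L (\<lambda>x. ?f x * g x)"
    using ae meas g by (intro integrable_cong_AE) auto
  also have "\<dots>" unfolding expand using int_fg by auto
  finally show "integrable M (\<lambda>x. g (Z x))"
    by (subst (asm) distributed_integrable[OF Z' g]) auto
  have "(\<integral>x. g (Z x) \<partial>M) = (\<integral>x. max 0 (?f x) * g x \<partial>L)"
    by (rule distributed_integral[OF Z' g, symmetric]) auto
  also have "\<dots> = (\<integral>x. ?f x * g x \<partial>L)"
    using ae meas g by (intro integral_cong_AE) auto
  also have "\<dots> = (\<Sum>i\<in>I. w i * (\<integral>x. f i x * g x \<partial>L))"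
    unfolding expand using int_fg by simp
  also have "\<dots> = (\<Sum>i\<in>I. w i * (\<integral>x. g (Y i x) \<partial>N i))"
    using transfer(2) g by (intro sum.cong) auto
  finally show "(\<integral>x. g (Z x) \<partial>M) = (\<Sum>i\<in>I. w i * (\<integral>x. g (Y i x) \<partial>N i))" .
qed

section \<open>Moments of the Weibull distribution\<close>

text \<open>This is \<open>ln s \<le> s - 1\<close> at \<open>s = v / (2 * a)\<close>, multiplied by
  \<open>a\<close> and exponentiated; the term \<open>- a\<close> is dropped.\<close>

lemma powr_le_exp_half:
  fixes v a :: real
  assumes "v > 0" "a > 0"
  shows "v powr a \<le> (2 * a) powr a * exp (v / 2)"
proof -
  have "ln (v / (2 * a)) \<le> v / (2 * a) - 1"
    using assms by (intro ln_le_minus_one) simp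
  then have "a * ln v \<le> a * ln (2 * a) + v / 2 - a"
    using assms by (simp add: ln_div field_simps)
  then have "exp (a * ln v) \<le> exp (a * ln (2 * a) + v / 2)"
    using assms by simp
  then show ?thesis using assms by (simp add: powr_def exp_add)
qed

lemma weibull_density_nonneg: "k > 0 \<Longrightarrow> l > 0 \<Longrightarrow> 0 \<le> weibull_density k l t"
  by (simp add: weibull_density_def)

lemma weibull_density_measurable [measurable]: "weibull_density k l \<in> borel_measurable borel"
  unfolding weibull_density_def[abs_def] by measurable

lemma integrable_weibull_density_exp_half:
  assumes k: "k > 0" and l: "l > 0"
  shows "integrable lborel (\<lambda>x. weibull_density k l x * exp ((x / l) powr k / 2))"
proof -
  \<comment> \<open>The extra factor halves the exponent of the density, and the substitution
    \<open>u = (x / l) powr k\<close> leads to this primitive, rising from -2 at \<open>0\<close> to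
    0 at infinity.\<close>
  define F where "F x = - 2 * exp (- ((x / l) powr k / 2))" for x
  define f where "f x = k / l * (x / l) powr (k - 1) * exp (- ((x / l) powr k / 2))" for x
  have "set_integrable lborel (einterval 0 \<infinity>) f"
  proof (rule interval_integral_FTC_nonneg(1)[where F = F and A = "-2" and B = 0])
    show "DERIV F x :> f x" if "0 < ereal x" "ereal x < \<infinity>" for x
      using that l unfolding F_def f_def
      by (auto intro!: derivative_eq_intros simp: powr_diff)
    show "isCont f x" if "0 < ereal x" "ereal x < \<infinity>" for x
      using that l unfolding f_def by (auto intro!: continuous_intros)
    show "AE x in lborel. 0 < ereal x \<longrightarrow> ereal x < \<infinity> \<longrightarrow> 0 \<le> f x"
      using k l by (simp add: f_def)
    \<comment> \<open>At base 0, the limit of \<open>powr\<close> relies on a positive exponent and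
      an eventually nonnegative base.\<close>
    have "\<forall>\<^sub>F x in at_right 0. 0 \<le> x / l"
      using l eventually_at_right_less[of "0::real"] by (auto elim!: eventually_mono)
    then have "(F \<longlongrightarrow> F 0) (at_right 0)"
      unfolding F_def using k l by (auto intro!: tendsto_eq_intros)
    then show "((F \<circ> real_of_ereal) \<longlongrightarrow> -2) (at_right 0)"
      using k by (simp add: ereal_tendsto_simps F_def zero_ereal_def)
    have "filterlim (\<lambda>x. (x / l) powr k / 2) at_top at_top"
      using k l by real_asymp
    then have "((\<lambda>x. - 2 * exp (- ((x / l) powr k / 2))) \<longlongrightarrow> - 2 * 0) at_top"
      by (intro tendsto_mult tendsto_const filterlim_compose[OF exp_at_bot]
          filterlim_compose[OF filterlim_uminus_at_bot_at_top])
    then show "((F \<circ> real_of_ereal) \<longlongrightarrow> 0) (at_left \<infinity>)"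
      by (simp add: ereal_tendsto_simps F_def[abs_def])
  qed simp
  also have "einterval 0 \<infinity> = {0<..}" by (auto simp: einterval_def)
  finally have "integrable lborel (\<lambda>x. indicator {0<..} x *\<^sub>R f x)"
    by (simp add: set_integrable_def)
  also have "(\<lambda>x. indicator {0<..} x *\<^sub>R f x)
      = (\<lambda>x. weibull_density k l x * exp ((x / l) powr k / 2))"
    by (rule ext) (simp add: f_def weibull_density_def indicator_def mult.assoc flip: exp_add)
  finally show ?thesis .
qed

text \<open>Domination: the power costs only half of the exponential decay, and what remains is
  integrable by the previous lemma.\<close>

lemma integrable_weibull_density_power:
  assumes k: "k > 0" and l: "l > 0" and h: "h \<ge> (1::nat)"
  shows "integrable lborel (\<lambda>x. weibull_density k l x * x ^ h)"
proof (rule Bochner_Integration.integrable_bound)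
  \<comment> \<open>Chosen so that \<open>((x / l) powr k) powr a = (x / l) ^ h\<close> for positive
    \<open>x\<close>; it is positive because \<open>h \<ge> 1\<close>.\<close>
  define a where "a = real h / k"
  define C where "C = l ^ h * (2 * a) powr a"
  show "integrable lborel (\<lambda>x. C * (weibull_density k l x * exp ((x / l) powr k / 2)))"
    by (rule integrable_mult_right) (rule integrable_weibull_density_exp_half[OF k l])
  have "norm (weibull_density k l x * x ^ h)
      \<le> norm (C * (weibull_density k l x * exp ((x / l) powr k / 2)))" for x
  proof (cases "x > 0")
    case True
    have "x ^ h = l ^ h * ((x / l) powr k) powr a"
      using True k l h by (simp add: a_def powr_powr powr_realpow power_divide)
    also have "\<dots> \<le> l ^ h * ((2 * a) powr a * exp ((x / l) powr k / 2))"
      using True k l h by (intro mult_left_mono powr_le_exp_half) (auto simp: a_def)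
    finally have "x ^ h \<le> C * exp ((x / l) powr k / 2)" by (simp add: C_def)
    then have "weibull_density k l x * x ^ h
        \<le> weibull_density k l x * (C * exp ((x / l) powr k / 2))"
      by (intro mult_left_mono weibull_density_nonneg k l)
    then show ?thesis
      using True weibull_density_nonneg[OF k l, of x] l by (simp add: abs_mult C_def mult_ac)
  qed (simp add: weibull_density_def)
  then show "AE x in lborel. norm (weibull_density k l x * x ^ h)
      \<le> norm (C * (weibull_density k l x * exp ((x / l) powr k / 2)))" by simp
qed measurable

section \<open>The identities for the mixed hypoexponential Weibull distribution\<close>

theorem theorem9:
  fixes n :: nat and k :: real and l :: "nat \<Rightarrow> real"
    and M :: "'a measure" and Z :: "'a \<Rightarrow> real"
    and N :: "nat \<Rightarrow> 'b measure" and Y :: "nat \<Rightarrow> 'b \<Rightarrow> real"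
  assumes "n \<ge> 2" and "k > 0"
    and "\<And>i. i \<in> {1..n} \<Longrightarrow> l i > 0" and "inj_on l {1..n}"
    and "prob_space M"
    and "distributed M lborel Z (\<lambda>t. ennreal (mhw_density n k l t))"
    and "\<And>i. i \<in> {1..n} \<Longrightarrow> prob_space (N i)"
    and "\<And>i. i \<in> {1..n} \<Longrightarrow>
           distributed (N i) lborel (Y i) (\<lambda>t. ennreal (weibull_density k (l i) t))"
  shows "(\<forall>t. cdf (distr M borel Z) t
              = (\<Sum>i=1..n. 1 / PW n k l i * cdf (distr (N i) borel (Y i)) t))
       \<and> (\<forall>t. reliability M Z t = (\<Sum>i=1..n. 1 / PW n k l i * reliability (N i) (Y i) t))
       \<and> (\<forall>t. reliability M Z t > 0 \<longrightarrow>
              hazard_rate M Z (mhw_density n k l) t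
              = (\<Sum>i=1..n. 1 / PW n k l i * weibull_density k (l i) t)
                / (\<Sum>i=1..n. 1 / PW n k l i * reliability (N i) (Y i) t))
       \<and> (\<forall>t. (\<forall>i\<in>{1..n}. integrable (N i) (\<lambda>x. exp (t * Y i x))) \<longrightarrow>
              integrable M (\<lambda>x. exp (t * Z x))
              \<and> mgf M Z t = (\<Sum>i=1..n. 1 / PW n k l i * mgf (N i) (Y i) t))
       \<and> (\<forall>h::nat. h \<ge> 1 \<longrightarrow>
              (\<forall>i\<in>{1..n}. integrable (N i) (\<lambda>x. Y i x ^ h))
              \<and> integrable M (\<lambda>x. Z x ^ h)
              \<and> (\<integral>x. Z x ^ h \<partial>M) = (\<Sum>i=1..n. 1 / PW n k l i * (\<integral>x. Y i x ^ h \<partial>(N i))))"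
proof -
  interpret M: prob_space M by fact
  note k = assms(2) and l = assms(3) and Z = assms(6) and N = assms(7) and Y = assms(8)
  have w: "(\<Sum>i=1..n. 1 / PW n k l i) = 1"
    using assms(1-4) by (intro sum_inverse_PW) auto
  have mixture: "integrable M (\<lambda>x. g (Z x))"
      "(\<integral>x. g (Z x) \<partial>M) = (\<Sum>i=1..n. 1 / PW n k l i * (\<integral>x. g (Y i x) \<partial>N i))"
    if g: "g \<in> borel_measurable borel"
      and int: "\<And>i. i \<in> {1..n} \<Longrightarrow> integrable (N i) (\<lambda>x. g (Y i x))" for g :: "real \<Rightarrow> real"
    using signed_mixture_expectation[where g = g, OF assms(5) w Z[unfolded mhw_density_def] N Y _ _ int]
      g weibull_density_nonneg[OF k l] by auto
  have [measurable]: "Z \<in> borel_measurable M"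
    using distributed_measurable[OF Z] by simp
  have Ymeas: "Y i \<in> borel_measurable (N i)" if "i \<in> {1..n}" for i
    using distributed_measurable[OF Y[OF that]] by simp
  \<comment> \<open>The case of an indicator as test function: \<open>{..t}\<close> will give the
    distribution function and \<open>{t<..}\<close> the reliability.\<close>
  have prob: "measure M {x \<in> space M. Z x \<in> A}
      = (\<Sum>i=1..n. 1 / PW n k l i * measure (N i) {x \<in> space (N i). Y i x \<in> A})"
    if A[measurable]: "A \<in> sets borel" for A
  proof -
    \<comment> \<open>Stated over a fresh type, since \<open>M\<close> and the \<open>N i\<close>
      live on different types.\<close>
    have ind: "(\<integral>x. indicator A (X x) \<partial>K) = measure K {x \<in> space K. X x \<in> A}"
      if [measurable]: "X \<in> borel_measurable K" for K :: "'c measure" and X :: "'c \<Rightarrow> real"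
    proof -
      have "(\<integral>x. indicator A (X x) \<partial>K) = (\<integral>x. indicator {x \<in> space K. X x \<in> A} x \<partial>K)"
        by (rule Bochner_Integration.integral_cong) (auto simp: indicator_def)
      also have "\<dots> = measure K {x \<in> space K. X x \<in> A}"
        by (simp add: Int_absorb2)
      finally show ?thesis .
    qed
    have int: "integrable (N i) (\<lambda>x. indicator A (Y i x) :: real)" if i: "i \<in> {1..n}" for i
    proof -
      interpret prob_space "N i" using N i .
      note [measurable] = Ymeas[OF i]
      show ?thesis by (rule integrable_const_bound[where B = 1]) (auto simp: indicator_def)
    qed
    show ?thesis
      using mixture(2)[of "indicator A", OF _ int] by (simp add: ind Ymeas)
  qed
  have cdf: "cdf (distr M borel Z) t
      = (\<Sum>i=1..n. 1 / PW n k l i * cdf (distr (N i) borel (Y i)) t)" for t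
  proof -
    have eq: "cdf (distr K borel X) t = measure K {x \<in> space K. X x \<in> {..t}}"
      if "X \<in> borel_measurable K" for K :: "'c measure" and X
      using that by (simp add: cdf_def measure_distr vimage_def Int_def conj_commute)
    show ?thesis
      using prob[of "{..t}"] by (simp add: eq Ymeas)
  qed
  have rel: "reliability M Z t = (\<Sum>i=1..n. 1 / PW n k l i * reliability (N i) (Y i) t)" for t
    using prob[of "{t<..}"] by (simp add: reliability_def)
  \<comment> \<open>For powers, unlike for the moment generating function, integrability is proved
    and not assumed.\<close>
  have moment: "integrable (N i) (\<lambda>x. Y i x ^ h)" if i: "i \<in> {1..n}" and h: "h \<ge> 1" for i h
    using distributed_integrable[OF Y[OF i], of "\<lambda>x. x ^ h"] weibull_density_nonneg[OF k l[OF i]]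
      integrable_weibull_density_power[OF k l[OF i] h] by auto
  have mgf: "integrable M (\<lambda>x. exp (t * Z x))
      \<and> mgf M Z t = (\<Sum>i=1..n. 1 / PW n k l i * mgf (N i) (Y i) t)"
    if "\<forall>i\<in>{1..n}. integrable (N i) (\<lambda>x. exp (t * Y i x))" for t
    using mixture[of "\<lambda>x. exp (t * x)"] that by (simp add: mgf_def)
  have mom: "integrable M (\<lambda>x. Z x ^ h)
      \<and> (\<integral>x. Z x ^ h \<partial>M) = (\<Sum>i=1..n. 1 / PW n k l i * (\<integral>x. Y i x ^ h \<partial>(N i)))"
    if "h \<ge> 1" for h
    using mixture[of "\<lambda>x. x ^ h"] moment[OF _ that] by simp
  show ?thesis
  proof (intro conjI allI impI ballI)
    fix t
    show "hazard_rate M Z (mhw_density n k l) t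
        = (\<Sum>i=1..n. 1 / PW n k l i * weibull_density k (l i) t)
          / (\<Sum>i=1..n. 1 / PW n k l i * reliability (N i) (Y i) t)"
      unfolding hazard_rate_def mhw_density_def rel ..
  qed (use cdf rel mgf mom moment in blast)+
qed

end
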